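(* Let $N\ge 1$ be an integer, let $K$ be an odd positive integer, and let $r=(N+1)^2$. Let $\{m_1,\dots,m_r\}$ be a basis of the space of (restrictions to $\mathbb{S}^2$ of) real polynomials of degree at most $N$, set $\boldsymbol{m}(\Omega)=(m_1(\Omega),\dots,m_r(\Omega))^\top$, and define $\boldsymbol{M}:\mathbb{R}^r\to\mathbb{R}^r$ by $$\boldsymbol{M}(\boldsymbol{\lambda})=\int_{\mathbb{S}^2}\boldsymbol{m}(\Omega)\left(1+\frac{\boldsymbol{\lambda}\cdot\boldsymbol{m}(\Omega)}{K}\right)^K\,\mathrm{d}\Omega .$$ Then for any $\boldsymbol{\rho}^*\in\mathbb{R}^r$ there exists a unique vector $\boldsymbol{\lambda}^*\in\mathbb{R}^r$ such that $\boldsymbol{\rho}^*=\boldsymbol{M}(\boldsymbol{\lambda}^* )$.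
   Context: $\mathbb{S}^2\subset\mathbb{R}^3$ is the unit sphere and $\mathrm{d}\Omega$ is its surface measure (total mass $4\pi$). The space of restrictions to $\mathbb{S}^2$ of real polynomials in three variables of degree at most $N$ has dimension $(N+1)^2$. The dot denotes the Euclidean inner product on $\mathbb{R}^r$. *)

theory Defs
  imports "HOL-Analysis.Analysis"
begin

abbreviation S2 :: "(real^3) set" where
  "S2 \<equiv> sphere 0 1"

text \<open>
  Surface measure of the unit sphere, as a measure on the Borel subsets of \<open>S2\<close>. It is given by the
  standard coordinate-free formula
  \<open>\<Omega>(A) = 3 * vol {t x | 0 < t < 1, x \<in> A}\<close> (lemma \<open>emeasure_S2_measure\<close>):
  the image of Lebesgue measure on the punctured unit ball under \<open>x \<mapsto> x / |x|\<close>, where the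
  factor 3 is the reciprocal of the integral of \<open>t^2\<close> over \<open>[0, 1]\<close> in polar coordinates.
  The lemmas below show that it has total mass \<open>4 * pi\<close> and is invariant under orthogonal
  maps, and these two properties determine it.
\<close>

definition S2_measure :: "(real^3) measure" where
  "S2_measure = scale_measure 3
     (distr (restrict_space lborel (ball 0 1 - {0})) (restrict_space borel S2) sgn)"

lemma space_S2_measure [simp]: "space S2_measure = S2"
  by (simp add: S2_measure_def space_scale_measure space_restrict_space)

lemma sets_S2_measure [measurable_cong, simp]:
  "sets S2_measure = sets (restrict_space borel S2)"
  by (simp add: S2_measure_def)

lemma borel_measurable_sgn_vec [measurable]: "(sgn :: real^3 \<Rightarrow> real^3) \<in> borel_measurable borel"
  unfolding sgn_div_norm by measurable

lemma sgn_measurable_S2: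
  "sgn \<in> restrict_space lborel (ball 0 1 - {0}) \<rightarrow>\<^sub>M restrict_space borel S2"
  by (intro measurable_restrict_space3)
     (auto simp: norm_sgn)

lemma sgn_vimage_ball:
  fixes A :: "(real^3) set"
  assumes "A \<subseteq> S2"
  shows "sgn -` A \<inter> (ball 0 1 - {0}) = {t *\<^sub>R x | t x. 0 < t \<and> t < 1 \<and> x \<in> A}" (is "?L = ?R")
proof
  show "?L \<subseteq> ?R"
  proof
    fix y assume y: "y \<in> ?L"
    then have "y = norm y *\<^sub>R sgn y" "0 < norm y" "norm y < 1" "sgn y \<in> A"
      by (auto simp: sgn_div_norm)
    then show "y \<in> ?R" by blast
  qed
  show "?R \<subseteq> ?L"
  proof
    fix y assume "y \<in> ?R"
    then obtain t x where tx: "y = t *\<^sub>R x" "0 < t" "t < 1" "x \<in> A" by blast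
    then have "norm x = 1" using assms by auto
    then show "y \<in> ?L" using tx by (auto simp: sgn_scaleR sgn_div_norm)
  qed
qed

lemma emeasure_S2_measure:
  assumes "A \<in> sets borel" "A \<subseteq> S2"
  shows "emeasure S2_measure A =
    3 * emeasure lborel {t *\<^sub>R x | t x. 0 < t \<and> t < 1 \<and> x \<in> A}"
proof -
  have A: "A \<in> sets (restrict_space borel S2)"
    using assms by (auto simp: sets_restrict_space_iff)
  have "emeasure S2_measure A = 3 * emeasure (restrict_space lborel (ball 0 1 - {0}))
      (sgn -` A \<inter> (ball 0 1 - {0}))"
    unfolding S2_measure_def using A
    by (simp add: emeasure_distr[OF sgn_measurable_S2] space_restrict_space)
  also have "\<dots> = 3 * emeasure lborel (sgn -` A \<inter> (ball 0 1 - {0}))"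
    by (subst emeasure_restrict_space) auto
  finally show ?thesis
    using sgn_vimage_ball[OF assms(2)] by simp
qed

lemma emeasure_S2_measure_S2: "emeasure S2_measure S2 = ennreal (4 * pi)"
proof -
  have "sgn -` S2 \<inter> (ball 0 1 - {0}) = (ball 0 1 - {0} :: (real^3) set)"
    by (auto simp: norm_sgn)
  then have "{t *\<^sub>R x | t x. 0 < t \<and> t < 1 \<and> x \<in> S2} = ball 0 1 - {0}"
    using sgn_vimage_ball[of S2] by blast
  then have "emeasure S2_measure S2 = 3 * emeasure lborel (ball (0::real^3) 1 - {0})"
    by (subst emeasure_S2_measure) auto
  also have "emeasure lborel (ball (0::real^3) 1 - {0}) = emeasure lborel (ball (0::real^3) 1)"
    by (intro emeasure_Diff_null_set) auto
  also have "\<dots> = ennreal (4 / 3 * pi)"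
    by (subst emeasure_ball) (auto simp: eval_unit_ball_vol)
  also have "3 * \<dots> = ennreal 3 * ennreal (4 / 3 * pi)" by simp
  also have "\<dots> = ennreal (4 * pi)" by (subst ennreal_mult[symmetric]) auto
  finally show ?thesis .
qed

lemma S2_measure_orthogonal_image:
  assumes f: "orthogonal_transformation f" and A: "A \<in> sets borel" "A \<subseteq> S2"
  shows "emeasure S2_measure (f ` A) = emeasure S2_measure A"
proof -
  let ?C = "\<lambda>A. {t *\<^sub>R x | t x. 0 < t \<and> t < 1 \<and> x \<in> (A :: (real^3) set)}"
  have lin: "linear f" and bij: "bij f"
    using f orthogonal_transformation_linear orthogonal_transformation_bij by auto
  obtain g where g: "orthogonal_transformation g" "g = inv f"
    using orthogonal_transformation_inv[OF f] by blast
  have img: "f ` A = g -` A"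
    using bij g(2) by (simp add: bij_image_Collect_eq bij_vimage_eq_inv_image inv_inv_eq bij_imp_bij_inv)
  have "g \<in> borel_measurable borel"
    using g(1) orthogonal_transformation_linear linear_continuous_on linear_linear
    by (intro borel_measurable_continuous_onI) blast
  then have fA: "f ` A \<in> sets borel"
    using measurable_sets[of g borel borel A] A img by simp
  have fS: "f ` A \<subseteq> S2"
    using A(2) f by (auto simp: orthogonal_transformation_norm)
  have CB: "?C B \<in> lmeasurable \<and> ?C B \<in> sets borel" if B: "B \<in> sets borel" "B \<subseteq> S2" for B
  proof -
    have "sgn -` B \<in> sets borel"
      using measurable_sets[OF borel_measurable_sgn_vec B(1)] by simp
    then have b: "?C B \<in> sets borel"
      using sgn_vimage_ball[OF B(2)] by (metis (no_types, lifting) sets.Int sets.Diff borel_open open_ball borel_closed closed_singleton)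
    have "?C B \<subseteq> ball 0 1" using sgn_vimage_ball[OF B(2)] by blast
    then have "bounded (?C B)" using bounded_subset bounded_ball by blast
    with b show ?thesis by (auto intro: bounded_set_imp_lmeasurable)
  qed
  have "?C (f ` A) = f ` ?C A"
    using linear_scale[OF lin] by (auto simp: image_iff) metis+
  then have "measure lebesgue (?C (f ` A)) = measure lebesgue (?C A)"
    using measure_orthogonal_image[OF f] CB[OF A] by simp
  then have "emeasure lebesgue (?C (f ` A)) = emeasure lebesgue (?C A)"
    using CB[OF A] CB[OF fA fS] by (simp add: emeasure_eq_measure2 fmeasurableD2)
  then have "emeasure lborel (?C (f ` A)) = emeasure lborel (?C A)"
    using CB[OF A] CB[OF fA fS] by simp
  then show ?thesis
    using emeasure_S2_measure[OF A] emeasure_S2_measure[OF fA fS] by simp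
qed

definition polys3 :: "nat \<Rightarrow> (real^3 \<Rightarrow> real) set" where
  "polys3 N = {\<lambda>x. \<Sum>i\<le>N. \<Sum>j\<le>N - i. \<Sum>k\<le>N - i - j. a i j k * x$1 ^ i * x$2 ^ j * x$3 ^ k
              | a. True}"

text \<open>
  The components of \<open>m\<close> form a basis of the space of restrictions to \<open>S2\<close> of the functions in
  \<open>polys3 N\<close>: they belong to it, are linearly independent and span it. Two functions are
  identified when they agree on \<open>S2\<close>; the values of \<open>m\<close> elsewhere are irrelevant.
\<close>

definition S2_poly_basis :: "nat \<Rightarrow> (real^3 \<Rightarrow> real^'r) \<Rightarrow> bool" where
  "S2_poly_basis N m \<longleftrightarrow>
     (\<forall>i. \<exists>p\<in>polys3 N. \<forall>\<Omega>\<in>S2. m \<Omega> $ i = p \<Omega>) \<and>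
     (\<forall>c :: 'r \<Rightarrow> real. (\<forall>\<Omega>\<in>S2. (\<Sum>i\<in>UNIV. c i * m \<Omega> $ i) = 0) \<longrightarrow> (\<forall>i. c i = 0)) \<and>
     (\<forall>p\<in>polys3 N. \<exists>c :: 'r \<Rightarrow> real. \<forall>\<Omega>\<in>S2. p \<Omega> = (\<Sum>i\<in>UNIV. c i * m \<Omega> $ i))"

definition moment_map :: "nat \<Rightarrow> (real^3 \<Rightarrow> real^'r) \<Rightarrow> real^'r \<Rightarrow> real^'r" where
  "moment_map K m lam =
     (LINT \<Omega>|S2_measure. (1 + (lam \<bullet> m \<Omega>) / real K) ^ K *\<^sub>R m \<Omega>)"

end

theory Submission
  imports Defs
begin

text \<open>
  The map \<open>M\<close> is monotone, because \<open>t \<mapsto> (1 + t / K) ^ K\<close> is increasing for odd \<open>K\<close>; it is strictly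
  monotone because a nonzero \<open>\<lambda> \<bullet> m\<close> cannot vanish on a set of full measure, whence uniqueness.
  For existence, \<open>(u - 1) (u ^ K - 1) \<ge> (u - 1)\<^sup>2 / 2\<close> for odd \<open>K\<close> gives
  \<open>\<lambda> \<bullet> (M \<lambda> - M 0) \<ge> (\<integral> (\<lambda> \<bullet> m)\<^sup>2) / (2 K) \<ge> c |\<lambda>|\<^sup>2\<close> with \<open>c > 0\<close>, so \<open>M - \<rho>\<close> points
  outwards on a large sphere, and a continuous vector field with this property has a zero by
  Brouwer's theorem.
\<close>

section \<open>Zeros of outward-pointing vector fields\<close>

text \<open>Brouwer's theorem is applied to \<open>x - f x\<close> followed by the nearest-point
  projection onto the ball. If \<open>f x\<close> were nonzero at the fixed point, then
  \<open>x\<close> would lie on the boundary with \<open>f x\<close> pointing strictly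
  inwards.\<close>

lemma outward_field_has_zero:
  fixes f :: "'a::euclidean_space \<Rightarrow> 'a"
  assumes "R > 0" and cont: "continuous_on (cball 0 R) f"
    and outward: "\<And>x. norm x = R \<Longrightarrow> 0 \<le> f x \<bullet> x"
  obtains x where "x \<in> cball 0 R" "f x = 0"
proof -
  let ?B = "cball (0::'a) R"
  let ?P = "\<lambda>x. closest_point ?B (x - f x)"
  have ne: "?B \<noteq> {}" using \<open>R > 0\<close> by auto
  have "continuous_on ?B ?P"
    by (rule continuous_on_compose2[OF continuous_on_closest_point[OF convex_cball closed_cball ne]])
      (rule continuous_on_diff continuous_on_id cont subset_UNIV)+
  moreover have "?P \<in> ?B \<rightarrow> ?B"
    using closest_point_in_set[OF closed_cball ne] by auto
  ultimately obtain x where x: "x \<in> ?B" and fixed_pt: "?P x = x"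
    by (rule brouwer[OF compact_cball convex_cball ne])
  \<comment> \<open>The obtuse-angle property of the projection of \<open>x - f x\<close>, which is
    \<open>x\<close> itself: \<open>x\<close> minimises the linear functional
    \<open>f x \<bullet> y\<close> over the ball.\<close>
  have dot: "f x \<bullet> x \<le> f x \<bullet> y" if "y \<in> ?B" for y
    using closest_point_dot[OF convex_cball closed_cball that, of "x - f x"]
    by (simp add: fixed_pt inner_diff_right)
  have "f x = 0"
  proof (rule ccontr)
    assume nz: "f x \<noteq> 0"
    \<comment> \<open>The point of the ball where this functional takes its least value
      \<open>- (R * norm (f x))\<close>; by Cauchy-Schwarz, \<open>x\<close> can match that value
      only if \<open>norm x = R\<close>.\<close>
    let ?y = "- (R / norm (f x)) *\<^sub>R f x"
    have "f x \<bullet> x \<le> - (R * norm (f x))"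
      using dot[of ?y] nz \<open>R > 0\<close> by (simp add: dot_square_norm power2_eq_square)
    moreover have "- (norm (f x) * norm x) \<le> f x \<bullet> x"
      using Cauchy_Schwarz_ineq2[of "f x" x] by linarith
    ultimately have "R * norm (f x) \<le> norm x * norm (f x)"
      by (simp add: mult.commute)
    then have "norm x = R" using nz x by auto
    then have "0 \<le> f x \<bullet> x" by (rule outward)
    moreover have "0 < R * norm (f x)" using nz \<open>R > 0\<close> by simp
    ultimately show False using \<open>f x \<bullet> x \<le> - (R * norm (f x))\<close> by linarith
  qed
  with x that show thesis by blast
qed

section \<open>Inequalities for odd powers\<close>

text \<open>After division by \<open>(u - 1)\<^sup>2\<close> this bounds the geometric sum
  \<open>s n = 1 + u + ... + u ^ (2 * n)\<close> below by 1/2, uniformly in \<open>n\<close>.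
  Induction works because \<open>s (n + 1) = u\<^sup>2 * s n + u + 1\<close>.\<close>

lemma odd_power_minus_one_mult_ge:
  fixes u :: real
  assumes "odd K"
  shows "(u - 1)\<^sup>2 / 2 \<le> (u - 1) * (u ^ K - 1)"
proof -
  have "(u - 1)\<^sup>2 / 2 \<le> (u - 1) * (u ^ (2 * n + 1) - 1)" for n
  proof (induction n)
    case 0
    show ?case by (simp add: power2_eq_square)
  next
    case (Suc n)
    \<comment> \<open>Completing the square:
      \<open>u\<^sup>2 / 2 + u + 1 = 1 / 2 + (u + 1)\<^sup>2 / 2\<close>, multiplied by
      \<open>(u - 1)\<^sup>2\<close>.\<close>
    have "(u - 1)\<^sup>2 / 2 + (u - 1)\<^sup>2 * (u + 1)\<^sup>2 / 2 = u\<^sup>2 * ((u - 1)\<^sup>2 / 2) + (u - 1)\<^sup>2 * (u + 1)"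
      by (simp add: power2_eq_square field_simps)
    also have "\<dots> \<le> u\<^sup>2 * ((u - 1) * (u ^ (2 * n + 1) - 1)) + (u - 1)\<^sup>2 * (u + 1)"
      using mult_left_mono[OF Suc.IH, of "u\<^sup>2"] by simp
    also have "\<dots> = (u - 1) * (u ^ (2 * Suc n + 1) - 1)"
      by (simp add: power2_eq_square algebra_simps)
    finally show ?case
      by (smt (verit) divide_nonneg_nonneg mult_nonneg_nonneg zero_le_power2)
  qed
  with assms show ?thesis by (metis oddE)
qed

lemma diff_mult_odd_power_diff_nonneg:
  fixes a b :: real
  assumes "odd K"
  shows "0 \<le> (a - b) * (a ^ K - b ^ K)"
  using power_mono_odd[OF assms, of a b] power_mono_odd[OF assms, of b a]
  by (cases "a \<le> b") (auto intro: mult_nonpos_nonpos)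

lemma diff_mult_odd_power_diff_eq_0_iff:
  fixes a b :: real
  assumes "odd K"
  shows "(a - b) * (a ^ K - b ^ K) = 0 \<longleftrightarrow> a = b"
  using odd_real_root_power_cancel[OF assms] by (metis diff_self eq_iff_diff_eq_0 mult_eq_0_iff)

section \<open>Integration of continuous functions over the sphere\<close>

lemma finite_measure_S2_measure: "finite_measure S2_measure"
  by (rule finite_measureI) (simp add: emeasure_S2_measure_S2)

lemma borel_measurable_S2_measure:
  fixes f :: "real^3 \<Rightarrow> 'b::topological_space"
  assumes "continuous_on S2 f"
  shows "f \<in> borel_measurable S2_measure"
  using borel_measurable_continuous_on_restrict[OF assms]
  by (simp cong: measurable_cong_sets)

lemma integrable_S2_measure:
  fixes f :: "real^3 \<Rightarrow> 'b::{banach, second_countable_topology}"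
  assumes "continuous_on S2 f"
  shows "integrable S2_measure f"
proof -
  interpret finite_measure S2_measure by (rule finite_measure_S2_measure)
  have "bounded (f ` S2)"
    using assms compact_continuous_image compact_imp_bounded compact_sphere by blast
  then obtain B where "\<forall>x\<in>S2. norm (f x) \<le> B"
    unfolding bounded_iff by auto
  then show ?thesis
    by (intro integrable_const_bound[where B = B] borel_measurable_S2_measure assms AE_I2) auto
qed

text \<open>Dominated convergence along a sequence of parameters. The sequence together with its
  limit is compact, so \<open>f\<close> is bounded on its product with \<open>S2\<close>, and this
  bound is a constant majorant.\<close>

lemma continuous_on_integral_S2_measure:
  fixes f :: "'a::heine_borel \<Rightarrow> real^3 \<Rightarrow> 'b::{banach, second_countable_topology}"
  assumes "continuous_on (UNIV \<times> S2) (\<lambda>(x, y). f x y)"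
  shows "continuous_on UNIV (\<lambda>x. LINT y|S2_measure. f x y)"
proof (rule continuous_on_sequentiallyI)
  fix X and x :: 'a
  assume X: "X \<longlonglongrightarrow> x"
  interpret finite_measure S2_measure by (rule finite_measure_S2_measure)
  let ?C = "insert x (range X)"
  have sec: "continuous_on S2 (f z)" for z
    using continuous_on_compose2[OF assms, of S2 "\<lambda>y. (z, y)"] by (simp add: continuous_on_Pair image_subset_iff)
  have sec': "continuous_on UNIV (\<lambda>z. f z y)" if "y \<in> S2" for y
    using continuous_on_compose2[OF assms, of UNIV "\<lambda>z. (z, y)"] that
    by (simp add: continuous_on_Pair image_subset_iff)
  have "compact (?C \<times> S2)"
    using compact_sequence_with_limit[OF X] by (intro compact_Times) auto
  moreover have "continuous_on (?C \<times> S2) (\<lambda>(x, y). f x y)"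
    using assms by (rule continuous_on_subset) auto
  ultimately have "bounded ((\<lambda>(x, y). f x y) ` (?C \<times> S2))"
    using compact_continuous_image compact_imp_bounded by blast
  then obtain B where B: "\<And>z y. z \<in> ?C \<Longrightarrow> y \<in> S2 \<Longrightarrow> norm (f z y) \<le> B"
    unfolding bounded_iff by fastforce
  show "(\<lambda>n. LINT y|S2_measure. f (X n) y) \<longlonglongrightarrow> (LINT y|S2_measure. f x y)"
  proof (rule integral_dominated_convergence[where w = "\<lambda>_. B"])
    show "AE y in S2_measure. (\<lambda>n. f (X n) y) \<longlonglongrightarrow> f x y"
      using continuous_on_tendsto_compose[OF sec' X] by (intro AE_I2) auto
    show "AE y in S2_measure. norm (f (X n) y) \<le> B" for n
      using B by (intro AE_I2) auto
  qed (auto intro: borel_measurable_S2_measure sec)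
qed

text \<open>This holds because the surface measure charges every nonempty relatively open subset of the sphere.\<close>

lemma integral_S2_measure_eq_0D:
  fixes f :: "real^3 \<Rightarrow> real"
  assumes cont: "continuous_on S2 f" and nonneg: "\<And>y. y \<in> S2 \<Longrightarrow> 0 \<le> f y"
    and int: "(LINT y|S2_measure. f y) = 0" and x: "x \<in> S2"
  shows "f x = 0"
proof (rule ccontr)
  assume nz: "f x \<noteq> 0"
  let ?A = "{y \<in> S2. f y \<noteq> 0}"
  \<comment> \<open>The cone over \<open>?A\<close> without its apex. Its volume is a third of the
    surface measure of \<open>?A\<close>, hence zero; yet it is open, as \<open>sgn\<close> is
    continuous away from 0, and it contains \<open>x / 2\<close>.\<close>
  let ?U = "{y \<in> ball 0 1 - {0}. f (sgn y) \<noteq> 0}"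
  have "?A \<in> sets S2_measure"
    using measurable_sets[OF borel_measurable_S2_measure[OF cont], of "- {0}"]
    by (simp add: vimage_def Int_def conj_commute)
  then have A: "?A \<in> sets borel"
    by (simp add: sets_restrict_space_iff)
  have "AE y in S2_measure. f y = 0"
    using integral_nonneg_eq_0_iff_AE[OF integrable_S2_measure[OF cont] AE_I2] nonneg int by simp
  then have "emeasure S2_measure ?A = 0"
    using AE_iff_measurable[of ?A S2_measure "\<lambda>y. f y = 0"] \<open>?A \<in> sets S2_measure\<close> by auto
  moreover have "{t *\<^sub>R y | t y. 0 < t \<and> t < 1 \<and> y \<in> ?A} = ?U"
    by (subst sgn_vimage_ball[symmetric]) (auto simp: norm_sgn)
  ultimately have "emeasure lborel ?U = 0"
    using emeasure_S2_measure[OF A Collect_restrict] by simp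
  have "continuous_on (ball 0 1 - {0}) (\<lambda>y::real^3. f (sgn y))"
    by (intro continuous_on_compose2[OF cont])
      (auto simp: norm_sgn intro!: continuous_intros split: if_splits)
  then have "open ?U"
    using continuous_open_preimage[of "ball 0 1 - {0}" "\<lambda>y. f (sgn y)" "- {0}"]
    by (simp add: vimage_def Int_def open_Diff open_Compl)
  moreover have "(1 / 2) *\<^sub>R x \<in> ?U"
    using x nz by (auto simp: sgn_scaleR sgn_div_norm)
  ultimately have "\<not> negligible ?U"
    using open_not_negligible by blast
  moreover have "?U \<in> null_sets lebesgue"
    using \<open>emeasure lborel ?U = 0\<close> \<open>open ?U\<close> by (auto simp: null_sets_def)
  ultimately show False by (simp add: negligible_iff_null_sets)
qed

section \<open>Continuity and independence of the basis\<close>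

lemma continuous_on_polys3: "p \<in> polys3 N \<Longrightarrow> continuous_on A p"
  unfolding polys3_def by (auto intro!: continuous_intros)

lemma S2_poly_basis_continuous_on:
  assumes "S2_poly_basis N m"
  shows "continuous_on S2 m"
proof -
  have "continuous_on S2 (\<lambda>y. m y $ i)" for i
  proof -
    from assms obtain p where "p \<in> polys3 N" "\<forall>y\<in>S2. m y $ i = p y"
      unfolding S2_poly_basis_def by blast
    then show ?thesis
      using continuous_on_polys3 continuous_on_cong by metis
  qed
  then have "continuous_on S2 (\<lambda>y. \<chi> i. m y $ i)"
    by (rule continuous_on_vec_lambda)
  then show ?thesis by simp
qed

lemma S2_poly_basis_independent:
  assumes "S2_poly_basis N m" "\<And>y. y \<in> S2 \<Longrightarrow> v \<bullet> m y = 0"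
  shows "v = 0"
proof -
  have "(\<forall>y\<in>S2. (\<Sum>i\<in>UNIV. v $ i * m y $ i) = 0) \<longrightarrow> (\<forall>i. v $ i = 0)"
    using assms(1) unfolding S2_poly_basis_def by blast
  with assms(2) show ?thesis by (simp add: vec_eq_iff inner_vec_def)
qed

section \<open>The moment map: continuity and injectivity\<close>

context
  fixes N K :: nat and m :: "real^3 \<Rightarrow> real^'r"
  assumes basis: "S2_poly_basis N m" and K: "odd K"
begin

lemma continuous_on_inner_basis [continuous_intros]: "continuous_on S2 (\<lambda>y. v \<bullet> m y)"
  by (intro continuous_intros S2_poly_basis_continuous_on[OF basis])

lemma continuous_on_moment_map: "continuous_on UNIV (moment_map K m)"
proof -
  have "continuous_on (UNIV \<times> S2) (\<lambda>z. m (snd z))"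
    by (rule continuous_on_compose2[OF S2_poly_basis_continuous_on[OF basis]])
      (auto intro!: continuous_intros)
  then have "continuous_on UNIV (\<lambda>v. LINT y|S2_measure. (1 + (v \<bullet> m y) / real K) ^ K *\<^sub>R m y)"
    by (intro continuous_on_integral_S2_measure)
      (auto simp: case_prod_unfold divide_inverse intro!: continuous_intros)
  then show ?thesis
    by (simp add: moment_map_def[abs_def])
qed

lemma inner_moment_map:
  "w \<bullet> moment_map K m v = (LINT y|S2_measure. (w \<bullet> m y) * (1 + (v \<bullet> m y) / real K) ^ K)"
proof -
  have "integrable S2_measure (\<lambda>y. (1 + (v \<bullet> m y) / real K) ^ K *\<^sub>R m y)"
    unfolding divide_inverse
    by (intro integrable_S2_measure continuous_intros S2_poly_basis_continuous_on[OF basis])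
  from integral_inner_right[OF this, of w] show ?thesis
    unfolding moment_map_def by (simp add: mult.commute)
qed

text \<open>The direction \<open>w\<close> is kept separate from \<open>u\<close> and
  \<open>v\<close>: injectivity takes \<open>w = u - v\<close>, coercivity compares a vector with 0
  in its own direction.\<close>

lemma inner_moment_map_diff:
  "w \<bullet> (moment_map K m u - moment_map K m v) = (LINT y|S2_measure.
     (w \<bullet> m y) * ((1 + (u \<bullet> m y) / real K) ^ K - (1 + (v \<bullet> m y) / real K) ^ K))"
proof -
  have "integrable S2_measure (\<lambda>y. (w \<bullet> m y) * (1 + (u \<bullet> m y) / real K) ^ K)" for u
    unfolding divide_inverse
    by (intro integrable_S2_measure continuous_intros)
  then show ?thesis
    by (simp add: inner_diff_right inner_moment_map right_diff_distrib Bochner_Integration.integral_diff)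
qed

lemma inj_moment_map: "inj (moment_map K m)"
proof (rule injI)
  fix u v assume eq: "moment_map K m u = moment_map K m v"
  have K0: "real K > 0" using K odd_pos by simp
  let ?a = "\<lambda>w y. 1 + (w \<bullet> m y) / real K"
  let ?f = "\<lambda>y. (?a u y - ?a v y) * (?a u y ^ K - ?a v y ^ K)"
  \<comment> \<open>Since \<open>?a u y - ?a v y\<close> is \<open>(u - v) \<bullet> m y\<close>
    divided by \<open>K\<close>, the monotonicity integrand is, up to this factor, the one in the
    pairing of \<open>u - v\<close> with the difference of moments.\<close>
  have "?f y = inverse (real K) * (((u - v) \<bullet> m y) * (?a u y ^ K - ?a v y ^ K))" for y
    using K0 by (simp add: inner_diff_left field_simps)
  then have "(LINT y|S2_measure. ?f y) = inverse (real K) * ((u - v) \<bullet> (moment_map K m u - moment_map K m v))"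
    by (simp only: inner_moment_map_diff integral_mult_right_zero)
  then have int: "(LINT y|S2_measure. ?f y) = 0"
    by (simp add: eq)
  have cont: "continuous_on S2 ?f"
    unfolding divide_inverse by (intro continuous_intros)
  have "(u - v) \<bullet> m y = 0" if "y \<in> S2" for y
  proof -
    have "?f y = 0"
      using cont diff_mult_odd_power_diff_nonneg[OF K] int that by (rule integral_S2_measure_eq_0D)
    then have "?a u y = ?a v y"
      using diff_mult_odd_power_diff_eq_0_iff[OF K] by blast
    then show ?thesis using K0 by (simp add: inner_diff_left)
  qed
  then have "u - v = 0" by (rule S2_poly_basis_independent[OF basis])
  then show "u = v" by simp
qed

section \<open>Coercivity and surjectivity of the moment map\<close>

text \<open>The form is continuous, and positive on the compact unit sphere by independence of the
  basis. Its minimum there, the least eigenvalue of the Gram matrix of \<open>m\<close>, serves as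
  \<open>c\<close>; homogeneity extends the bound to all \<open>v\<close>.\<close>

lemma gram_form_ge:
  obtains c where "c > 0" "\<And>v. c * (norm v)\<^sup>2 \<le> (LINT y|S2_measure. (v \<bullet> m y)\<^sup>2)"
proof -
  let ?q = "\<lambda>v. LINT y|S2_measure. (v \<bullet> m y)\<^sup>2"
  have "continuous_on (UNIV \<times> S2) (\<lambda>z. m (snd z))"
    by (rule continuous_on_compose2[OF S2_poly_basis_continuous_on[OF basis]])
      (auto intro!: continuous_intros)
  then have "continuous_on UNIV ?q"
    by (intro continuous_on_integral_S2_measure)
      (auto simp: case_prod_unfold intro!: continuous_intros)
  then have "continuous_on (sphere 0 1) ?q"
    by (rule continuous_on_subset) simp
  then obtain w where w: "w \<in> sphere 0 1" and min: "\<And>v. v \<in> sphere 0 1 \<Longrightarrow> ?q w \<le> ?q v"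
    using continuous_attains_inf[of "sphere (0 :: real^'r) 1" ?q] by auto
  have "?q w \<noteq> 0"
  proof
    assume 0: "?q w = 0"
    have "(w \<bullet> m y)\<^sup>2 = 0" if "y \<in> S2" for y
      by (rule integral_S2_measure_eq_0D[OF _ _ 0 that]) (auto intro!: continuous_intros)
    then have "w = 0" using S2_poly_basis_independent[OF basis, of w] by simp
    with w show False by simp
  qed
  moreover have "0 \<le> ?q w" by (rule Bochner_Integration.integral_nonneg) simp
  ultimately have pos: "?q w > 0" by linarith
  have "?q w * (norm v)\<^sup>2 \<le> ?q v" for v
  proof (cases "v = 0")
    case False
    then have "(v \<bullet> m y)\<^sup>2 = (norm v)\<^sup>2 * (sgn v \<bullet> m y)\<^sup>2" for y
      by (simp add: sgn_div_norm power_mult_distrib power_divide field_simps)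
    then have "?q v = (norm v)\<^sup>2 * ?q (sgn v)" by simp
    moreover have "?q w \<le> ?q (sgn v)"
      using False by (intro min) (simp add: norm_sgn)
    ultimately show ?thesis
      by (simp add: mult.commute mult_left_mono)
  qed simp
  with pos that show thesis by blast
qed

lemma moment_map_coercive:
  obtains c where "c > 0"
    "\<And>v. c * (norm v)\<^sup>2 \<le> v \<bullet> (moment_map K m v - moment_map K m 0)"
proof -
  obtain c where c: "c > 0" "\<And>v. c * (norm v)\<^sup>2 \<le> (LINT y|S2_measure. (v \<bullet> m y)\<^sup>2)"
    using gram_form_ge by blast
  have K0: "real K > 0" using K odd_pos by simp
  have "c / (2 * real K) * (norm v)\<^sup>2 \<le> v \<bullet> (moment_map K m v - moment_map K m 0)" for v
  proof -
    \<comment> \<open>The odd-power inequality at \<open>u = 1 + (v \<bullet> m y) / K\<close>,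
      multiplied by \<open>K\<close>. The subtracted 1 is the value of the power at the zero vector,
      so integration yields the difference from \<open>moment_map K m 0\<close>.\<close>
    have "(v \<bullet> m y)\<^sup>2 / (2 * real K) \<le> (v \<bullet> m y) * ((1 + (v \<bullet> m y) / real K) ^ K - 1)" for y
      using mult_left_mono[OF odd_power_minus_one_mult_ge[OF K, of "1 + (v \<bullet> m y) / real K"], of "real K"] K0
      by (simp add: power2_eq_square field_simps)
    then have "(LINT y|S2_measure. (v \<bullet> m y)\<^sup>2 / (2 * real K)) \<le>
        (LINT y|S2_measure. (v \<bullet> m y) * ((1 + (v \<bullet> m y) / real K) ^ K - 1))"
      unfolding divide_inverse
      by (intro integral_mono integrable_S2_measure continuous_intros)
    also have "\<dots> = v \<bullet> (moment_map K m v - moment_map K m 0)"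
      by (simp add: inner_moment_map_diff)
    finally show ?thesis
      using divide_right_mono[OF c(2)[of v], of "2 * real K"] K0 by simp
  qed
  with c(1) K0 show thesis by (intro that[of "c / (2 * real K)"]) auto
qed

lemma surj_moment_map: "surj (moment_map K m)"
proof -
  obtain c where c: "c > 0"
    "\<And>v. c * (norm v)\<^sup>2 \<le> v \<bullet> (moment_map K m v - moment_map K m 0)"
    using moment_map_coercive by blast
  have "\<exists>v. moment_map K m v = \<rho>" for \<rho>
  proof -
    let ?d = "norm (\<rho> - moment_map K m 0)"
    \<comment> \<open>With \<open>?d / c\<close> the quadratic lower bound
      \<open>c * R\<^sup>2\<close> already matches the linear term \<open>R * ?d\<close>; the added
      1 keeps \<open>R\<close> positive when \<open>\<rho> = moment_map K m 0\<close>.\<close>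
    define R where "R = ?d / c + 1"
    have R: "R > 0" "?d \<le> c * R"
      using c(1) by (auto simp: R_def field_simps intro: add_pos_nonneg)
    have "0 \<le> (moment_map K m v - \<rho>) \<bullet> v" if v: "norm v = R" for v
    proof -
      have "v \<bullet> (\<rho> - moment_map K m 0) \<le> R * ?d"
        using norm_cauchy_schwarz[of v] v by simp
      also have "\<dots> \<le> c * R\<^sup>2"
        using mult_left_mono[OF R(2), of R] R(1) by (simp add: power2_eq_square mult_ac)
      also have "\<dots> \<le> v \<bullet> (moment_map K m v - moment_map K m 0)"
        using c(2)[of v] v by simp
      finally show ?thesis
        by (simp add: inner_diff_right inner_commute)
    qed
    moreover have "continuous_on (cball 0 R) (\<lambda>v. moment_map K m v - \<rho>)"
      by (intro continuous_intros continuous_on_subset[OF continuous_on_moment_map]) simp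
    ultimately obtain v where "moment_map K m v - \<rho> = 0"
      using outward_field_has_zero[OF R(1)] by blast
    then show ?thesis by auto
  qed
  then show ?thesis by (metis surjI)
qed

end

theorem proposition2:
  fixes N K :: nat and m :: "real^3 \<Rightarrow> real^'r"
  assumes "N \<ge> 1"
    and "K > 0" and "odd K"
    and "CARD('r) = (N + 1)^2"
    and "S2_poly_basis N m"
  shows "\<forall>\<rho> :: real^'r. \<exists>!lam :: real^'r. \<rho> = moment_map K m lam"
proof
  fix \<rho> :: "real^'r"
  obtain lam where lam: "\<rho> = moment_map K m lam"
    using surj_moment_map[OF assms(5,3)] by (rule surjE)
  show "\<exists>!lam. \<rho> = moment_map K m lam"
  proof (rule ex1I[of _ lam])
    fix v assume "\<rho> = moment_map K m v"
    then have "moment_map K m v = moment_map K m lam"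
      using lam by (rule subst)
    then show "v = lam" by (rule injD[OF inj_moment_map[OF assms(5,3)]])
  qed (rule lam)
qed

end
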